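(* Let $(X,r)$ be a left non-degenerate solution and let $(X,r')$ be the derived solution of $(X,r)$. Then $r$ is $D$-isomorphic to $r'$.
   Context: A solution $(X,r)$ is a set $X$ with a map $r:X\times X\to X\times X$ satisfying the braid identity $(r\times \mathrm{id}_X)(\mathrm{id}_X\times r)(r\times\mathrm{id}_X)=(\mathrm{id}_X\times r)(r\times\mathrm{id}_X)(\mathrm{id}_X\times r)$. Writing $r(a,b)=(\sigma_a(b),\tau_b(a))$, $r$ is left non-degenerate if every $\sigma_a$ is a bijection of $X$. The derived solution of a left non-degenerate solution $(X,r)$ is the (left non-degenerate) solution $r'(a,b)=\big(b,\ \sigma_b\tau_{\sigma_a^{-1}(b)}(a)\big)$ on $X$. Two solutions $(X,r)$ and $(Y,s)$ are $D$-isomorphic (Drinfel'd isomorphic) if there is a bijection $\varphi:X\times X\to Y\times Y$ such that $\varphi\, r=s\,\varphi$. *)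

theory Defs
  imports "HOL-Library.FuncSet"
begin

text \<open>A pair \<open>(X, r)\<close> is encoded by a carrier set \<open>X\<close> and a function \<open>r\<close> of which only
  the values on \<open>X \<times> X\<close> matter. Triples are nested to the right,
  so \<open>r \<times> id\<close> acts on \<open>(a, b, c)\<close> after reassociation.\<close>

definition r_id :: "('a \<times> 'a \<Rightarrow> 'a \<times> 'a) \<Rightarrow> 'a \<times> 'a \<times> 'a \<Rightarrow> 'a \<times> 'a \<times> 'a" where
  "r_id r = (\<lambda>(a, b, c). (fst (r (a, b)), snd (r (a, b)), c))"

definition id_r :: "('a \<times> 'a \<Rightarrow> 'a \<times> 'a) \<Rightarrow> 'a \<times> 'a \<times> 'a \<Rightarrow> 'a \<times> 'a \<times> 'a" where
  "id_r r = (\<lambda>(a, b, c). (a, r (b, c)))"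

definition solution :: "'a set \<Rightarrow> ('a \<times> 'a \<Rightarrow> 'a \<times> 'a) \<Rightarrow> bool" where
  "solution X r \<longleftrightarrow> r \<in> X \<times> X \<rightarrow> X \<times> X \<and>
     (\<forall>t \<in> X \<times> X \<times> X. (r_id r \<circ> id_r r \<circ> r_id r) t = (id_r r \<circ> r_id r \<circ> id_r r) t)"

text \<open>The components of \<open>r (a, b) = (\<sigma>\<^sub>a b, \<tau>\<^sub>b a)\<close>.\<close>

definition sigma :: "('a \<times> 'a \<Rightarrow> 'a \<times> 'a) \<Rightarrow> 'a \<Rightarrow> 'a \<Rightarrow> 'a" where
  "sigma r a b = fst (r (a, b))"

definition tau :: "('a \<times> 'a \<Rightarrow> 'a \<times> 'a) \<Rightarrow> 'a \<Rightarrow> 'a \<Rightarrow> 'a" where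
  "tau r b a = snd (r (a, b))"

definition left_nondegenerate :: "'a set \<Rightarrow> ('a \<times> 'a \<Rightarrow> 'a \<times> 'a) \<Rightarrow> bool" where
  "left_nondegenerate X r \<longleftrightarrow> (\<forall>a \<in> X. bij_betw (sigma r a) X X)"

definition derived :: "'a set \<Rightarrow> ('a \<times> 'a \<Rightarrow> 'a \<times> 'a) \<Rightarrow> 'a \<times> 'a \<Rightarrow> 'a \<times> 'a" where
  "derived X r = (\<lambda>(a, b). (b, sigma r b (tau r (inv_into X (sigma r a) b) a)))"

definition D_isomorphic ::
  "'a set \<Rightarrow> ('a \<times> 'a \<Rightarrow> 'a \<times> 'a) \<Rightarrow> 'b set \<Rightarrow> ('b \<times> 'b \<Rightarrow> 'b \<times> 'b) \<Rightarrow> bool" where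
  "D_isomorphic X r Y s \<longleftrightarrow> solution X r \<and> solution Y s \<and>
     (\<exists>\<phi>. bij_betw \<phi> (X \<times> X) (Y \<times> Y) \<and> (\<forall>p \<in> X \<times> X. \<phi> (r p) = s (\<phi> p)))"

text \<open>The derived map is again a left non-degenerate solution: the map
  \<open>(a, x, y) \<mapsto> (a, \<sigma>\<^sub>a x, \<sigma>\<^sub>a (\<sigma>\<^sub>x y))\<close> intertwines both
  \<open>r \<times> id\<close> and \<open>id \<times> r\<close> with their derived counterparts.\<close>

lemma left_nondegenerate_derived: "left_nondegenerate X (derived X r)"
proof -
  have "sigma (derived X r) a = id" for a
    by (auto simp: sigma_def derived_def)
  then show ?thesis by (simp add: left_nondegenerate_def)
qed

lemma solution_derived:
  assumes sol: "solution X r" and nd: "left_nondegenerate X r"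
  shows "solution X (derived X r)"
proof -
  let ?s = "sigma r" and ?t = "tau r" and ?d = "derived X r"
  have r: "r (a, b) = (?s a b, ?t b a)" for a b by (simp add: sigma_def tau_def)
  have cl: "?s a b \<in> X" "?t b a \<in> X" if "a \<in> X" "b \<in> X" for a b
    using sol that by (auto simp: solution_def sigma_def tau_def Pi_iff mem_Times_iff)
  have inv: "inv_into X (?s a) (?s a x) = x" if "a \<in> X" "x \<in> X" for a x
    using nd that by (auto simp: left_nondegenerate_def bij_betw_def)
  have sur: "\<exists>x \<in> X. b = ?s a x" if "a \<in> X" "b \<in> X" for a b
    using nd that unfolding left_nondegenerate_def bij_betw_def by blast
  have d: "?d (a, ?s a x) = (?s a x, ?s (?s a x) (?t x a))" if "a \<in> X" "x \<in> X" for a x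
    using inv[OF that] by (simp add: derived_def)
  have br: "?s (?s a x) (?s (?t x a) y) = ?s a (?s x y)"
      "?t (?s (?t x a) y) (?s a x) = ?s (?t (?s x y) a) (?t y x)"
      if "a \<in> X" "x \<in> X" "y \<in> X" for a x y
    using sol that by (auto simp: solution_def r_id_def id_r_def r)
  define J where "J = (\<lambda>(a, x, y). (a, ?s a x, ?s a (?s x y)))"
  let ?X3 = "X \<times> X \<times> X"
  have J1: "J (r_id r t) = r_id ?d (J t)" if "t \<in> ?X3" for t
    using that by (clarsimp simp: J_def r_id_def r d) (simp add: br(1))
  have J2: "J (id_r r t) = id_r ?d (J t)" if tX: "t \<in> ?X3" for t
  proof -
    obtain a x y where t: "t = (a, x, y)" and X: "a \<in> X" "x \<in> X" "y \<in> X" using tX by auto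
    have "?d (?s a x, ?s a (?s x y)) = ?d (?s a x, ?s (?s a x) (?s (?t x a) y))"
      using br X by simp
    also have "\<dots> = (?s a (?s x y), ?s (?s a (?s x y)) (?s (?t (?s x y) a) (?t y x)))"
      using d[of "?s a x" "?s (?t x a) y"] br X cl by simp
    also have "\<dots> = (?s a (?s x y), ?s a (?s (?s x y) (?t y x)))"
      using br(1)[of a "?s x y" "?t y x"] X cl by simp
    finally show ?thesis by (simp add: t J_def id_r_def r)
  qed
  have c1: "r_id r t \<in> ?X3" "id_r r t \<in> ?X3" if "t \<in> ?X3" for t
    using that cl by (auto simp: r_id_def id_r_def r)
  have "(r_id ?d \<circ> id_r ?d \<circ> r_id ?d) u = (id_r ?d \<circ> r_id ?d \<circ> id_r ?d) u" if u: "u \<in> ?X3" for u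
  proof -
    obtain a b c where abc: "u = (a, b, c)" "a \<in> X" "b \<in> X" "c \<in> X" using u by auto
    obtain x where x: "x \<in> X" "b = ?s a x" using sur abc by blast
    obtain z where z: "z \<in> X" "c = ?s a z" using sur abc by blast
    obtain y where y: "y \<in> X" "z = ?s x y" using sur x z by blast
    let ?v = "(a, x, y)"
    have v: "?v \<in> ?X3" and uv: "u = J ?v" using abc x y z by (auto simp: J_def)
    have "(r_id ?d \<circ> id_r ?d \<circ> r_id ?d) u = J ((r_id r \<circ> id_r r \<circ> r_id r) ?v)"
      unfolding uv comp_def by (simp only: J1 J2 c1 v)
    also have "(r_id r \<circ> id_r r \<circ> r_id r) ?v = (id_r r \<circ> r_id r \<circ> id_r r) ?v"
      using sol v unfolding solution_def by blast
    also have "J \<dots> = (id_r ?d \<circ> r_id ?d \<circ> id_r ?d) u"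
      unfolding uv comp_def by (simp only: J1 J2 c1 v)
    finally show ?thesis .
  qed
  moreover have "?d \<in> X \<times> X \<rightarrow> X \<times> X"
  proof (clarsimp simp: Pi_iff)
    fix a b assume X: "a \<in> X" "b \<in> X"
    obtain x where x: "x \<in> X" "b = ?s a x" using sur X by blast
    show "?d (a, b) \<in> X \<times> X"
      unfolding x(2) d[OF X(1) x(1)] using cl X x by blast
  qed
  ultimately show ?thesis by (auto simp: solution_def)
qed

end

theory Submission
  imports Defs
begin

text \<open>The D-isomorphism is \<open>\<phi> (a, x) = (a, \<sigma>\<^sub>a x)\<close>: it records \<open>x\<close> by its image under \<open>\<sigma>\<^sub>a\<close>, and
  the inverse \<open>\<sigma>\<^sub>a\<inverse>\<close> in the formula for \<open>r'\<close> undoes exactly this, since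
  \<open>r' (a, \<sigma>\<^sub>a x) = (\<sigma>\<^sub>a x, \<sigma> (\<tau>\<^sub>x a))\<close> with \<open>\<sigma>\<close> taken at the index \<open>\<sigma>\<^sub>a x\<close>,
  which is \<open>\<phi> (\<sigma>\<^sub>a x, \<tau>\<^sub>x a) = \<phi> (r (a, x))\<close>.
  Non-degeneracy makes \<open>\<phi>\<close> bijective fibre by fibre. The braid identity for \<open>r\<close> is what
  makes \<open>r'\<close> again a solution.\<close>

lemma bij_betw_fibrewise:
  assumes "\<And>a. a \<in> A \<Longrightarrow> bij_betw (f a) (B a) (C a)"
  shows "bij_betw (\<lambda>(a, x). (a, f a x)) (Sigma A B) (Sigma A C)"
proof (rule bij_betwI')
  fix p q assume "p \<in> Sigma A B" "q \<in> Sigma A B"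
  then show "((\<lambda>(a, x). (a, f a x)) p = (\<lambda>(a, x). (a, f a x)) q) = (p = q)"
    using assms by (auto simp: bij_betw_def inj_on_def)
next
  fix p assume "p \<in> Sigma A B"
  then show "(\<lambda>(a, x). (a, f a x)) p \<in> Sigma A C"
    using assms by (auto simp: bij_betw_def)
next
  fix q assume "q \<in> Sigma A C"
  then obtain a c where q: "q = (a, c)" "a \<in> A" "c \<in> C a" by auto
  then obtain x where "x \<in> B a" "c = f a x"
    using assms[of a] by (auto simp: bij_betw_def)
  then show "\<exists>p \<in> Sigma A B. q = (\<lambda>(a, x). (a, f a x)) p"
    using q by (auto intro!: bexI[of _ "(a, x)"])
qed

lemma derived_sigma:
  assumes "left_nondegenerate X r" "a \<in> X" "x \<in> X"
  shows "derived X r (a, sigma r a x) = (sigma r a x, sigma r (sigma r a x) (tau r x a))"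
proof -
  have "inv_into X (sigma r a) (sigma r a x) = x"
    using assms by (auto simp: left_nondegenerate_def bij_betw_def)
  then show ?thesis by (simp add: derived_def)
qed

theorem lemma2p12:
  fixes X :: "'a set" and r :: "'a \<times> 'a \<Rightarrow> 'a \<times> 'a"
  assumes "solution X r" and "left_nondegenerate X r"
  shows "D_isomorphic X r X (derived X r)"
proof -
  define \<phi> where "\<phi> = (\<lambda>(a, x). (a, sigma r a x))"
  have "bij_betw \<phi> (X \<times> X) (X \<times> X)"
    unfolding \<phi>_def using assms(2)
    by (intro bij_betw_fibrewise) (simp add: left_nondegenerate_def)
  moreover have "\<phi> (r p) = derived X r (\<phi> p)" if "p \<in> X \<times> X" for p
  proof -
    obtain a x where p: "p = (a, x)" "a \<in> X" "x \<in> X" using \<open>p \<in> X \<times> X\<close> by auto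
    have "r (a, x) = (sigma r a x, tau r x a)" by (simp add: sigma_def tau_def)
    then show ?thesis
      using derived_sigma[OF assms(2) p(2,3)] by (simp add: p(1) \<phi>_def)
  qed
  ultimately show ?thesis
    using assms solution_derived[OF assms] unfolding D_isomorphic_def by blast
qed

end
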